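(* Let $T$ be a Brownian isometry of covariance $\sigma>0$ on a complex Hilbert space $\mathcal{H}$. If $T$ satisfies $|T|\le|\mathrm{Re}\,T|$, then $T$ is a symmetry.
   Context: A bounded operator $T$ on $\mathcal{H}$ is a $2$-isometry if $T^{*2}T^2-2T^*T+I=0$. A $2$-isometry $T$ on $\mathcal{H}$ is a Brownian isometry of covariance $\sigma>0$ if $\sigma^2=\|T^*T-I\|$ and, with respect to some orthogonal decomposition $\mathcal{H}=\mathcal{H}_0\oplus\mathcal{H}_1$, $T$ has a block matrix form $$T=\begin{pmatrix} V & \sigma E\\ 0 & U\end{pmatrix},$$ where $V$ is an isometry on $\mathcal{H}_0$, $E:\mathcal{H}_1\to\mathcal{H}_0$ is an injective (linear) contraction whose range is contained in the null-space of $V^*$, and $U$ is unitary on $\mathcal{H}_1$ with $UE^*E=E^*EU$. A contraction is an operator of norm at most $1$. A symmetry is a unitary operator that is self-adjoint. $|T|=(T^*T)^{1/2}$ and $\mathrm{Re}\,T=\frac12(T+T^* )$; inequalities between self-adjoint operators are in the usual order. *)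

theory Defs
  imports "HOL-Analysis.Analysis"
begin

class complex_vector = real_vector +
  fixes scaleC :: "complex \<Rightarrow> 'a \<Rightarrow> 'a" (infixr "*\<^sub>C" 75)
  assumes scaleC_add_right: "c *\<^sub>C (x + y) = c *\<^sub>C x + c *\<^sub>C y"
    and scaleC_add_left: "(c + d) *\<^sub>C x = c *\<^sub>C x + d *\<^sub>C x"
    and scaleC_scaleC: "c *\<^sub>C d *\<^sub>C x = (c * d) *\<^sub>C x"
    and scaleC_one: "1 *\<^sub>C x = x"
    and scaleR_scaleC: "r *\<^sub>R x = complex_of_real r *\<^sub>C x"

text \<open>The inner product is linear in its first and antilinear in its second argument.
  Its real part is the inner product of the underlying real space; hence the norm is
  \<open>norm x = sqrt (Re (cinner x x))\<close>, and positive definiteness is inherited from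
  \<^class>\<open>real_inner\<close>.\<close>

class complex_inner = complex_vector + real_inner +
  fixes cinner :: "'a \<Rightarrow> 'a \<Rightarrow> complex"
  assumes cinner_add_left: "cinner (x + y) z = cinner x z + cinner y z"
    and cinner_scaleC_left: "cinner (c *\<^sub>C x) y = c * cinner x y"
    and cinner_commute: "cinner x y = cnj (cinner y x)"
    and inner_eq_Re_cinner: "inner x y = Re (cinner x y)"

class complex_hilbert = complex_inner + complete_space

instantiation complex :: complex_hilbert
begin

definition scaleC_complex :: "complex \<Rightarrow> complex \<Rightarrow> complex"
  where "scaleC_complex c x = c * x"

definition cinner_complex :: "complex \<Rightarrow> complex \<Rightarrow> complex"
  where "cinner_complex x y = x * cnj y"

instance
  by standard
    (simp_all add: scaleC_complex_def cinner_complex_def algebra_simps scaleR_conv_of_real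
      inner_complex_def)

end

text \<open>An operator from \<open>M\<close> to \<open>N\<close> is a function on the whole type of which only the values
  on \<open>M\<close> matter; \<open>M = N = UNIV\<close> gives the operators on the Hilbert space itself.\<close>

definition closed_csubspace :: "'a::complex_inner set \<Rightarrow> bool" where
  "closed_csubspace M \<longleftrightarrow> subspace M \<and> (\<forall>c. \<forall>x\<in>M. c *\<^sub>C x \<in> M) \<and> closed M"

definition orthogonal_decomposition :: "'a::complex_inner set \<Rightarrow> 'a set \<Rightarrow> bool" where
  "orthogonal_decomposition M N \<longleftrightarrow>
     closed_csubspace M \<and> closed_csubspace N \<and>
     (\<forall>x\<in>M. \<forall>y\<in>N. cinner x y = 0) \<and>
     (\<forall>z. \<exists>x\<in>M. \<exists>y\<in>N. z = x + y)"

definition bounded_op_on :: "'a::complex_inner set \<Rightarrow> 'a set \<Rightarrow> ('a \<Rightarrow> 'a) \<Rightarrow> bool" where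
  "bounded_op_on M N A \<longleftrightarrow>
     A \<in> M \<rightarrow> N \<and>
     (\<forall>x\<in>M. \<forall>y\<in>M. A (x + y) = A x + A y) \<and>
     (\<forall>c. \<forall>x\<in>M. A (c *\<^sub>C x) = c *\<^sub>C A x) \<and>
     (\<exists>K. \<forall>x\<in>M. norm (A x) \<le> K * norm x)"

text \<open>The relative version of \<^const>\<open>onorm\<close>.\<close>

definition onorm_on :: "'a::complex_inner set \<Rightarrow> ('a \<Rightarrow> 'a) \<Rightarrow> real" where
  "onorm_on M A = (SUP x\<in>M. norm (A x) / norm x)"

text \<open>For a bounded operator between closed subspaces of a Hilbert space the adjoint exists
  and is uniquely determined on \<open>N\<close>, so the choice is immaterial there.\<close>

definition adjoint_on :: "'a::complex_inner set \<Rightarrow> 'a set \<Rightarrow> ('a \<Rightarrow> 'a) \<Rightarrow> 'a \<Rightarrow> 'a" where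
  "adjoint_on M N A =
     (SOME B. B \<in> N \<rightarrow> M \<and> (\<forall>x\<in>M. \<forall>y\<in>N. cinner (A x) y = cinner x (B y)))"

definition contraction_on :: "'a::complex_inner set \<Rightarrow> 'a set \<Rightarrow> ('a \<Rightarrow> 'a) \<Rightarrow> bool" where
  "contraction_on M N A \<longleftrightarrow> bounded_op_on M N A \<and> onorm_on M A \<le> 1"

definition isometry_on :: "'a::complex_inner set \<Rightarrow> ('a \<Rightarrow> 'a) \<Rightarrow> bool" where
  "isometry_on M V \<longleftrightarrow> bounded_op_on M M V \<and> (\<forall>x\<in>M. adjoint_on M M V (V x) = x)"

definition unitary_on :: "'a::complex_inner set \<Rightarrow> ('a \<Rightarrow> 'a) \<Rightarrow> bool" where
  "unitary_on M U \<longleftrightarrow>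
     bounded_op_on M M U \<and>
     (\<forall>x\<in>M. adjoint_on M M U (U x) = x) \<and> (\<forall>x\<in>M. U (adjoint_on M M U x) = x)"

abbreviation bounded_op :: "('a::complex_inner \<Rightarrow> 'a) \<Rightarrow> bool" where
  "bounded_op \<equiv> bounded_op_on UNIV UNIV"

abbreviation cadjoint :: "('a::complex_inner \<Rightarrow> 'a) \<Rightarrow> 'a \<Rightarrow> 'a" where
  "cadjoint \<equiv> adjoint_on UNIV UNIV"

definition self_adjoint :: "('a::complex_inner \<Rightarrow> 'a) \<Rightarrow> bool" where
  "self_adjoint A \<longleftrightarrow> bounded_op A \<and> cadjoint A = A"

definition symmetry :: "('a::complex_inner \<Rightarrow> 'a) \<Rightarrow> bool" where
  "symmetry T \<longleftrightarrow> unitary_on UNIV T \<and> self_adjoint T"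

definition positive_op :: "('a::complex_inner \<Rightarrow> 'a) \<Rightarrow> bool" where
  "positive_op A \<longleftrightarrow> self_adjoint A \<and> (\<forall>x. 0 \<le> Re (cinner (A x) x))"

definition op_le :: "('a::complex_inner \<Rightarrow> 'a) \<Rightarrow> ('a \<Rightarrow> 'a) \<Rightarrow> bool" where
  "op_le A B \<longleftrightarrow> positive_op (\<lambda>x. B x - A x)"

text \<open>A positive operator on a Hilbert space has exactly one positive square root.\<close>

definition op_sqrt :: "('a::complex_inner \<Rightarrow> 'a) \<Rightarrow> 'a \<Rightarrow> 'a" where
  "op_sqrt A = (SOME P. positive_op P \<and> P \<circ> P = A)"

definition op_abs :: "('a::complex_inner \<Rightarrow> 'a) \<Rightarrow> 'a \<Rightarrow> 'a" where
  "op_abs T = op_sqrt (cadjoint T \<circ> T)"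

definition op_Re :: "('a::complex_inner \<Rightarrow> 'a) \<Rightarrow> 'a \<Rightarrow> 'a" where
  "op_Re T = (\<lambda>x. (1 / 2) *\<^sub>R (T x + cadjoint T x))"

definition two_isometry :: "('a::complex_inner \<Rightarrow> 'a) \<Rightarrow> bool" where
  "two_isometry T \<longleftrightarrow>
     bounded_op T \<and>
     (\<forall>x. cadjoint T (cadjoint T (T (T x))) - 2 *\<^sub>R cadjoint T (T x) + x = 0)"

definition brownian_isometry :: "real \<Rightarrow> ('a::complex_inner \<Rightarrow> 'a) \<Rightarrow> bool" where
  "brownian_isometry \<sigma> T \<longleftrightarrow>
     0 < \<sigma> \<and> two_isometry T \<and>
     \<sigma>\<^sup>2 = onorm (\<lambda>x. cadjoint T (T x) - x) \<and>
     (\<exists>H\<^sub>0 H\<^sub>1 V E U.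
        orthogonal_decomposition H\<^sub>0 H\<^sub>1 \<and>
        (\<forall>x\<in>H\<^sub>0. \<forall>y\<in>H\<^sub>1. T (x + y) = (V x + \<sigma> *\<^sub>R E y) + U y) \<and>
        isometry_on H\<^sub>0 V \<and>
        contraction_on H\<^sub>1 H\<^sub>0 E \<and> inj_on E H\<^sub>1 \<and>
        (\<forall>y\<in>H\<^sub>1. adjoint_on H\<^sub>0 H\<^sub>0 V (E y) = 0) \<and>
        unitary_on H\<^sub>1 U \<and>
        (\<forall>y\<in>H\<^sub>1. U (adjoint_on H\<^sub>1 H\<^sub>0 E (E y)) = adjoint_on H\<^sub>1 H\<^sub>0 E (E (U y))))"

end

theory Submission imports Defs begin

text \<open>Let \<open>x = V E y\<close>. Since \<open>T\<^sup>* V = I\<close> on \<open>H\<^sub>0\<close>, we have \<open>T\<^sup>* T x = x\<close>, hence \<open>\<bar>T\<bar> x = x\<close>, and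
  \<open>2 (Re T) x = V V E y + E y\<close> is a sum of two orthogonal vectors of norm \<open>\<parallel>x\<parallel>\<close>. Thus
  \<open>\<parallel>x\<parallel>\<^sup>2 = \<langle>\<bar>T\<bar> x, x\<rangle> \<le> \<langle>\<bar>Re T\<bar> x, x\<rangle> \<le> \<parallel>(Re T) x\<parallel> \<parallel>x\<parallel> = \<parallel>x\<parallel>\<^sup>2 / \<surd>2\<close>, so \<open>x = 0\<close>. As \<open>V\<close> and \<open>E\<close>
  are injective, \<open>H\<^sub>1 = 0\<close> and \<open>T = V\<close> is an isometry, contradicting \<open>\<sigma> > 0\<close>: no Brownian
  isometry of positive covariance satisfies the hypothesis.\<close>

section \<open>Complex inner products\<close>

lemma scaleC_zero_right: "c *\<^sub>C (0::'a::complex_vector) = 0"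
  using scaleC_add_right[of c 0 "0::'a"] by simp

lemma scaleC_minus_one: "(-1) *\<^sub>C (x::'a::complex_vector) = - x"
  using scaleR_scaleC[of "-1" x] by simp

lemma scaleC_minus_right: "c *\<^sub>C (- x) = - (c *\<^sub>C (x::'a::complex_vector))"
  using scaleC_scaleC[of c "-1" x] scaleC_scaleC[of "-1" c x] by (simp add: scaleC_minus_one)

lemma scaleC_diff_right: "c *\<^sub>C (x - y) = c *\<^sub>C x - c *\<^sub>C (y::'a::complex_vector)"
  using scaleC_add_right[of c x "- y"] by (simp add: scaleC_minus_right)

lemma scaleC_scaleR: "c *\<^sub>C (r *\<^sub>R x) = r *\<^sub>R (c *\<^sub>C (x::'a::complex_vector))"
  by (simp add: scaleR_scaleC scaleC_scaleC mult.commute)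

lemma cinner_add_right: "cinner x (y + z) = cinner x y + cinner x (z::'a::complex_inner)"
  by (metis cinner_add_left cinner_commute complex_cnj_add)

lemma cinner_diff_left: "cinner (x - y) z = cinner x z - cinner y (z::'a::complex_inner)"
  using cinner_add_left[of "x - y" y z] by simp

lemma cinner_diff_right: "cinner z (x - y) = cinner z x - cinner z (y::'a::complex_inner)"
  using cinner_add_right[of z "x - y" y] by simp

lemma cinner_scaleC_right: "cinner x (c *\<^sub>C y) = cnj c * cinner x (y::'a::complex_inner)"
  by (metis cinner_scaleC_left cinner_commute complex_cnj_mult)

lemma cinner_scaleR_left: "cinner (r *\<^sub>R x) y = complex_of_real r * cinner (x::'a::complex_inner) y"
  by (simp add: scaleR_scaleC cinner_scaleC_left)

lemma cinner_zero_left: "cinner 0 (y::'a::complex_inner) = 0"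
  using cinner_scaleR_left[of 0 0 y] by simp

lemma Im_cinner: "Im (cinner x y) = - inner (\<i> *\<^sub>C x) (y::'a::complex_inner)"
  by (simp add: inner_eq_Re_cinner cinner_scaleC_left)

text \<open>The real inner product determines the complex one, since the imaginary part is read off
  after multiplying by \<open>\<i>\<close>. Complex identities are thereby reduced to real ones, for
  which Riesz and limits are at hand.\<close>

lemma cinner_eq_iff_inner:
  "cinner x y = cinner x' (y'::'a::complex_inner) \<longleftrightarrow>
     inner x y = inner x' y' \<and> inner (\<i> *\<^sub>C x) y = inner (\<i> *\<^sub>C x') y'"
  by (auto simp: complex_eq_iff Im_cinner inner_eq_Re_cinner[of x] inner_eq_Re_cinner[of x'])

lemma norm_scaleC_i: "norm (\<i> *\<^sub>C (x::'a::complex_inner)) = norm x"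
  by (simp add: norm_eq_sqrt_inner inner_eq_Re_cinner cinner_scaleC_left cinner_scaleC_right)

section \<open>The Riesz representation theorem and adjoints\<close>

text \<open>The representing vector is the minimiser of the quadratic functional \<open>Q\<close>
  over \<open>M\<close>. The argument is purely real; complex linearity enters only in
  \<open>adjoint_exists\<close>.\<close>

lemma riesz_on_subspace:
  fixes f :: "'a::{real_inner,complete_space} \<Rightarrow> real"
  assumes M: "subspace M" "closed M"
    and add: "\<And>x y. x \<in> M \<Longrightarrow> y \<in> M \<Longrightarrow> f (x + y) = f x + f y"
    and scale: "\<And>r x. x \<in> M \<Longrightarrow> f (r *\<^sub>R x) = r * f x"
    and bound: "\<And>x. x \<in> M \<Longrightarrow> \<bar>f x\<bar> \<le> K * norm x"
  shows "\<exists>b\<in>M. \<forall>x\<in>M. f x = inner x b"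
proof -
  \<comment> \<open>If \<open>b\<close> represents \<open>f\<close>, then \<open>Q x\<close> is the
    squared distance from \<open>x\<close> to \<open>b\<close> minus the squared norm of
    \<open>b\<close>, so \<open>b\<close> has to be the minimiser.\<close>
  define Q where "Q = (\<lambda>x. inner x x - 2 * f x)"
  define m where "m = Inf (Q ` M)"
  have "0 \<in> M" using M(1) by (rule subspace_0)
  have lower: "- K\<^sup>2 \<le> Q x" if "x \<in> M" for x
  proof -
    have "2 * f x \<le> 2 * (K * norm x)" using bound[OF that] by linarith
    moreover have "0 \<le> (norm x - K)\<^sup>2" by simp
    ultimately show ?thesis
      by (simp add: Q_def power2_diff dot_square_norm algebra_simps)
  qed
  have bdd: "bdd_below (Q ` M)" using lower by (auto intro!: bdd_belowI)
  have m_le: "m \<le> Q x" if "x \<in> M" for x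
    unfolding m_def using bdd that by (simp add: cInf_lower)
  have "\<exists>x\<in>M. Q x < m + inverse (real (Suc n))" for n
  proof -
    have "\<exists>q\<in>Q ` M. q < m + inverse (real (Suc n))"
      unfolding m_def using \<open>0 \<in> M\<close> by (intro cInf_lessD) (auto simp del: of_nat_Suc)
    then show ?thesis by auto
  qed
  then obtain X where XM: "\<And>n. X n \<in> M" and XQ: "\<And>n. Q (X n) < m + inverse (real (Suc n))"
    by metis
  \<comment> \<open>By the parallelogram law and \<open>m \<le> Q h\<close> at the midpoint
    \<open>h\<close>, two near-minimisers are close to each other.\<close>
  have dist2: "(norm (x - y))\<^sup>2 \<le> 2 * (Q x - m) + 2 * (Q y - m)" if "x \<in> M" "y \<in> M" for x y
  proof -
    define h where "h = (1/2) *\<^sub>R (x + y)"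
    have mid: "h \<in> M" using M that by (simp add: h_def subspace_add subspace_scale)
    have "f h = (f x + f y) / 2"
      using that M by (simp add: h_def scale subspace_add add)
    then have "4 * Q h = 2 * Q x + 2 * Q y - (norm (x - y))\<^sup>2"
      by (simp add: Q_def h_def power2_norm_eq_inner inner_commute algebra_simps)
    then show ?thesis using m_le[OF mid] by simp
  qed
  have "Cauchy X"
  proof (rule metric_CauchyI)
    fix e :: real assume "e > 0"
    obtain N where N: "inverse (real (Suc N)) < e\<^sup>2 / 4"
      using reals_Archimedean[of "e\<^sup>2 / 4"] \<open>e > 0\<close> by auto
    have small: "Q (X n) - m < e\<^sup>2 / 4" if "n \<ge> N" for n
    proof -
      have "inverse (real (Suc n)) \<le> inverse (real (Suc N))" using that by simp
      then show ?thesis using XQ[of n] N by linarith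
    qed
    have "dist (X k) (X n) < e" if "k \<ge> N" "n \<ge> N" for k n
    proof -
      have "(norm (X k - X n))\<^sup>2 < e\<^sup>2"
        using dist2[OF XM XM, of k n] small[OF that(1)] small[OF that(2)] by simp
      then show ?thesis using \<open>e > 0\<close> by (simp add: dist_norm power2_less_imp_less)
    qed
    then show "\<exists>N. \<forall>k\<ge>N. \<forall>n\<ge>N. dist (X k) (X n) < e" by blast
  qed
  then obtain b where lim: "X \<longlonglongrightarrow> b" using Cauchy_convergent convergent_def by blast
  have bM: "b \<in> M" using closed_sequentially M(2) XM lim by blast
  have flim: "(\<lambda>n. f (X n)) \<longlonglongrightarrow> f b"
  proof -
    have "\<bar>f (X n) - f b\<bar> \<le> K * norm (X n - b)" for n
    proof -
      have d: "X n - b \<in> M" using M XM bM by (simp add: subspace_diff)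
      then have "f (X n) = f (X n - b) + f b" using add[OF d bM] by simp
      then show ?thesis using bound[OF d] by simp
    qed
    then have "\<forall>\<^sub>F n in sequentially. norm (f (X n) - f b) \<le> K * norm (X n - b)" by simp
    moreover have "(\<lambda>n. K * norm (X n - b)) \<longlonglongrightarrow> 0"
      by (intro tendsto_mult_right_zero tendsto_norm_zero LIM_zero lim)
    ultimately have "(\<lambda>n. f (X n) - f b) \<longlonglongrightarrow> 0" by (rule Lim_null_comparison)
    then show ?thesis by (simp add: LIM_zero_iff)
  qed
  have Qb: "Q b = m"
  proof (rule antisym)
    have "(\<lambda>n. Q (X n)) \<longlonglongrightarrow> Q b" unfolding Q_def by (intro tendsto_intros lim flim)
    moreover have "(\<lambda>n. m + inverse (real (Suc n))) \<longlonglongrightarrow> m + 0"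
      by (intro tendsto_intros LIMSEQ_inverse_real_of_nat)
    ultimately show "Q b \<le> m" using XQ by (intro LIMSEQ_le) (auto intro: less_imp_le)
  qed (use m_le bM in blast)
  have "f x = inner x b" if x: "x \<in> M" for x
  proof (cases "x = 0")
    case True
    then show ?thesis using bound[OF x] by simp
  next
    case False
    define c where "c = f x - inner x b"
    \<comment> \<open>This \<open>t\<close> minimises \<open>Q (b + t *\<^sub>R x)\<close>, where
      the value is \<open>Q b - t * c\<close>. Minimality of \<open>b\<close> therefore forces
      \<open>c = 0\<close>.\<close>
    define t where "t = c / inner x x"
    have pos: "inner x x > 0" using False by simp
    have "Q b \<le> Q (b + t *\<^sub>R x)"
      unfolding Qb using M bM x by (intro m_le) (simp add: subspace_add subspace_scale)
    also have "f (b + t *\<^sub>R x) = f b + t * f x"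
      using M bM x by (simp add: add scale subspace_scale)
    then have "Q (b + t *\<^sub>R x) = Q b + t * (t * inner x x) - 2 * t * c"
      by (simp add: Q_def c_def inner_add inner_commute algebra_simps)
    also have "t * inner x x = c" using pos by (simp add: t_def)
    finally have "c * t \<le> 0" by simp
    then have "c * c \<le> 0" using pos by (simp add: t_def divide_le_0_iff)
    then have "c = 0" by (metis mult_eq_0_iff not_real_square_gt_zero not_le)
    then show ?thesis by (simp add: c_def)
  qed
  then show ?thesis using bM by blast
qed

section \<open>Bounded operators and their adjoints\<close>

lemma bounded_op_on_scaleR:
  "bounded_op_on M N A \<Longrightarrow> x \<in> M \<Longrightarrow> A (r *\<^sub>R x) = r *\<^sub>R A x"
  by (simp add: bounded_op_on_def scaleR_scaleC)

lemma bounded_op_on_zero: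
  "bounded_op_on M N A \<Longrightarrow> subspace M \<Longrightarrow> A 0 = 0"
  using bounded_op_on_scaleR[of M N A 0 0] by (simp add: subspace_0)

lemma closed_csubspace_UNIV: "closed_csubspace UNIV"
  by (simp add: closed_csubspace_def)

text \<open>Riesz applies to the real functional sending \<open>x\<close> to
  \<open>inner (A x) y\<close>. The identity becomes complex because \<open>M\<close> is closed
  under multiplication by \<open>\<i>\<close> and \<open>A\<close> commutes with it. This justifies
  the choice in \<open>adjoint_on\<close>.\<close>

lemma adjoint_exists:
  fixes A :: "'a::complex_hilbert \<Rightarrow> 'a"
  assumes M: "closed_csubspace M" and A: "bounded_op_on M N A"
  shows "\<exists>B. B \<in> N \<rightarrow> M \<and> (\<forall>x\<in>M. \<forall>y\<in>N. cinner (A x) y = cinner x (B y))"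
proof -
  obtain K where K: "\<And>x. x \<in> M \<Longrightarrow> norm (A x) \<le> K * norm x"
    using A unfolding bounded_op_on_def by blast
  have iM: "\<i> *\<^sub>C x \<in> M" if "x \<in> M" for x using M that by (auto simp: closed_csubspace_def)
  have Ai: "A (\<i> *\<^sub>C x) = \<i> *\<^sub>C A x" if "x \<in> M" for x using A that by (auto simp: bounded_op_on_def)
  have "\<exists>b\<in>M. \<forall>x\<in>M. cinner (A x) y = cinner x b" for y
  proof -
    have "\<exists>b\<in>M. \<forall>x\<in>M. inner (A x) y = inner x b"
    proof (rule riesz_on_subspace[where K = "K * norm y"])
      show "\<bar>inner (A x) y\<bar> \<le> K * norm y * norm x" if "x \<in> M" for x
      proof -
        have "\<bar>inner (A x) y\<bar> \<le> norm (A x) * norm y" by (rule Cauchy_Schwarz_ineq2)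
        also have "\<dots> \<le> K * norm x * norm y" using K[OF that] by (intro mult_right_mono) auto
        finally show ?thesis by (simp add: mult_ac)
      qed
    qed (use M A bounded_op_on_scaleR[OF A] in
          \<open>auto simp: closed_csubspace_def bounded_op_on_def inner_add_left\<close>)
    then obtain b where b: "b \<in> M" "\<And>x. x \<in> M \<Longrightarrow> inner (A x) y = inner x b" by blast
    then show ?thesis using iM Ai by (metis cinner_eq_iff_inner)
  qed
  then obtain B where "\<And>y. B y \<in> M" "\<And>x y. x \<in> M \<Longrightarrow> cinner (A x) y = cinner x (B y)" by metis
  then show ?thesis by (intro exI[of _ B]) auto
qed

lemma cinner_adjoint_on:
  fixes A :: "'a::complex_hilbert \<Rightarrow> 'a"
  assumes "closed_csubspace M" "bounded_op_on M N A" "x \<in> M" "y \<in> N"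
  shows "cinner (A x) y = cinner x (adjoint_on M N A y)"
  using someI_ex[OF adjoint_exists[OF assms(1,2)]] assms(3,4) unfolding adjoint_on_def by blast

lemma cinner_cadjoint:
  fixes A :: "'a::complex_hilbert \<Rightarrow> 'a"
  shows "bounded_op A \<Longrightarrow> cinner (A x) y = cinner x (cadjoint A y)"
  by (rule cinner_adjoint_on[OF closed_csubspace_UNIV]) simp_all

lemma cinner_right_cancel:
  fixes b c :: "'a::complex_inner"
  assumes "\<And>x. cinner x b = cinner x c"
  shows "b = c"
proof -
  have "inner x b = inner x c" for x by (simp add: inner_eq_Re_cinner assms)
  then show ?thesis by (metis vector_eq_rdot inner_commute)
qed

text \<open>The given \<open>B\<close> witnesses that the choice in \<open>adjoint_on\<close>
  succeeds, and nondegeneracy of the inner product then gives uniqueness; completeness does not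
  enter.\<close>

lemma cadjoint_eqI:
  fixes A :: "'a::complex_inner \<Rightarrow> 'a"
  assumes "\<And>x y. cinner (A x) y = cinner x (B y)"
  shows "cadjoint A = B"
proof -
  have "\<exists>B. B \<in> UNIV \<rightarrow> UNIV \<and> (\<forall>x\<in>UNIV. \<forall>y\<in>UNIV. cinner (A x) y = cinner x (B y))"
    using assms by (intro exI[of _ B]) auto
  then have "cinner (A x) y = cinner x (cadjoint A y)" for x y
    unfolding adjoint_on_def by (rule someI2_ex) auto
  then have "cinner x (cadjoint A y) = cinner x (B y)" for x y using assms by metis
  then show ?thesis by (rule ext[OF cinner_right_cancel])
qed

lemma bounded_op_imp_bounded_linear:
  assumes "bounded_op A"
  shows "bounded_linear A"
proof -
  obtain K where "\<And>x. norm (A x) \<le> K * norm x"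
    using assms unfolding bounded_op_on_def by blast
  moreover have "A (x + y) = A x + A y" for x y using assms by (simp add: bounded_op_on_def)
  ultimately show ?thesis
    using bounded_op_on_scaleR[OF assms]
    by (intro bounded_linear_intro[where K = K]) (auto simp: mult.commute)
qed

lemma bounded_op_pos_bound:
  assumes "bounded_op A"
  obtains K where "K > 0" "\<And>x. norm (A x) \<le> K * norm x"
proof -
  obtain K where "K > 0" "\<And>x. norm (A x) \<le> norm x * K"
    using bounded_linear.pos_bounded[OF bounded_op_imp_bounded_linear[OF assms]] by blast
  then show ?thesis by (intro that[of K]) (simp_all add: mult.commute)
qed

lemma bounded_op_cadjoint:
  fixes A :: "'a::complex_hilbert \<Rightarrow> 'a"
  assumes A: "bounded_op A" and K: "\<And>x. norm (A x) \<le> K * norm x"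
  shows "bounded_op (cadjoint A)" and "norm (cadjoint A y) \<le> K * norm y"
proof -
  let ?B = "cadjoint A"
  have bound: "norm (?B y) \<le> K * norm y" for y
  proof (cases "?B y = 0")
    case True
    \<comment> \<open>The sign of \<open>K\<close> is not assumed; nonnegativity of
      \<open>K * norm y\<close> comes from the bound on \<open>A\<close>.\<close>
    then show ?thesis
      using order_trans[OF norm_ge_zero K[of y]] by simp
  next
    case False
    have "norm (?B y) * norm (?B y) = inner (?B y) (?B y)"
      by (metis power2_eq_square power2_norm_eq_inner)
    also have "\<dots> = inner (A (?B y)) y"
      by (simp add: inner_eq_Re_cinner cinner_cadjoint[OF A])
    also have "\<dots> \<le> norm (A (?B y)) * norm y" by (rule norm_cauchy_schwarz)
    also have "\<dots> \<le> K * norm (?B y) * norm y" using K by (intro mult_right_mono) auto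
    finally have "norm (?B y) * norm (?B y) \<le> norm (?B y) * (K * norm y)" by (simp add: mult_ac)
    then show ?thesis using False by simp
  qed
  then show "norm (?B y) \<le> K * norm y" .
  have "?B (x + y) = ?B x + ?B y" for x y
    by (rule cinner_right_cancel) (simp add: cinner_add_right flip: cinner_cadjoint[OF A])
  moreover have "?B (c *\<^sub>C x) = c *\<^sub>C ?B x" for c x
    by (rule cinner_right_cancel) (simp add: cinner_scaleC_right flip: cinner_cadjoint[OF A])
  ultimately show "bounded_op ?B" using bound by (auto simp: bounded_op_on_def)
qed

section \<open>Square roots\<close>

lemma self_adjointI:
  assumes "bounded_op A" and "\<And>x y. cinner (A x) y = cinner x (A y)"
  shows "self_adjoint A"
  unfolding self_adjoint_def using assms by (blast intro: cadjoint_eqI)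

lemma self_adjoint_cinner:
  fixes A :: "'a::complex_hilbert \<Rightarrow> 'a"
  assumes "self_adjoint A"
  shows "cinner (A x) y = cinner x (A y)"
  using assms cinner_cadjoint[of A x y] by (simp add: self_adjoint_def)

lemma bounded_opI:
  assumes "\<And>x y. A (x + y) = A x + A y" "\<And>c x. A (c *\<^sub>C x) = c *\<^sub>C A x"
    and "\<And>x. norm (A x) \<le> K * norm x"
  shows "bounded_op A"
  using assms by (auto simp: bounded_op_on_def)

lemma
  assumes "bounded_op A"
  shows bounded_op_add: "A (x + y) = A x + A y"
    and bounded_op_scaleC: "A (c *\<^sub>C x) = c *\<^sub>C A x"
  using assms by (auto simp: bounded_op_on_def)

text \<open>A fixed point \<open>Y\<close> of \<open>Y \<mapsto> (X + Y\<^sup>2) / 2\<close> satisfies \<open>(I - Y)\<^sup>2 = I - X\<close>. For a contraction \<open>X\<close> the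
  increments of the iteration are dominated in norm by those for the scalar \<open>X = 1\<close>, which form
  a convergent series.\<close>

primrec sqrt_iter :: "('a::complex_inner \<Rightarrow> 'a) \<Rightarrow> nat \<Rightarrow> 'a \<Rightarrow> 'a" where
  "sqrt_iter X 0 = (\<lambda>x. 0)"
| "sqrt_iter X (Suc n) = (\<lambda>x. (1/2) *\<^sub>R (X x + sqrt_iter X n (sqrt_iter X n x)))"

primrec sqrt_iter_real :: "nat \<Rightarrow> real" where
  "sqrt_iter_real 0 = 0"
| "sqrt_iter_real (Suc n) = (1 + (sqrt_iter_real n)\<^sup>2) / 2"

lemma sqrt_iter_real_bounds: "0 \<le> sqrt_iter_real n \<and> sqrt_iter_real n \<le> 1"
proof (induction n)
  case (Suc n)
  then have "(sqrt_iter_real n)\<^sup>2 \<le> 1" by (simp add: power_le_one)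
  then show ?case by (simp add: add_nonneg_nonneg)
qed simp

lemma sqrt_iter_real_le_Suc: "sqrt_iter_real n \<le> sqrt_iter_real (Suc n)"
proof -
  have "0 \<le> (1 - sqrt_iter_real n)\<^sup>2" by simp
  then show ?thesis by (simp add: power2_diff)
qed

lemma convergent_sqrt_iter_real: "convergent sqrt_iter_real"
proof -
  have "incseq sqrt_iter_real" by (intro incseq_SucI sqrt_iter_real_le_Suc)
  moreover have "\<forall>n. sqrt_iter_real n \<le> 1" using sqrt_iter_real_bounds by blast
  ultimately show ?thesis using incseq_convergent convergent_def by metis
qed

text \<open>The limit \<open>Y\<close> of the iterates inherits linearity, symmetry and
  contractivity, and the root is \<open>I - Y\<close>. It is positive because \<open>Y\<close> is a
  contraction.\<close>

lemma one_minus_square_root: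
  fixes X :: "'a::complex_hilbert \<Rightarrow> 'a"
  assumes X: "self_adjoint X" and X1: "\<And>x. norm (X x) \<le> norm x"
  shows "\<exists>P. positive_op P \<and> (\<forall>x. P (P x) = x - X x)"
proof -
  let ?Y = "sqrt_iter X" and ?y = "sqrt_iter_real"
  have bX: "bounded_op X" using X by (simp add: self_adjoint_def)
  have Yadd: "?Y n (x + y) = ?Y n x + ?Y n y" for n x y
    by (induction n arbitrary: x y) (auto simp: bounded_op_add[OF bX] algebra_simps)
  have Yc: "?Y n (c *\<^sub>C x) = c *\<^sub>C ?Y n x" for n c x
    by (induction n arbitrary: c x)
       (auto simp: bounded_op_scaleC[OF bX] scaleC_zero_right scaleC_scaleR scaleC_add_right)
  have Yadj: "cinner (?Y n x) y = cinner x (?Y n y)" for n x y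
  proof (induction n arbitrary: x y)
    case 0
    then show ?case using cinner_commute[of x 0] by (simp add: cinner_zero_left)
  next
    case (Suc n)
    then show ?case
      by (simp add: scaleR_scaleC cinner_scaleC_left cinner_scaleC_right cinner_add_left
          cinner_add_right self_adjoint_cinner[OF X])
  qed
  have Ydiff: "?Y n (x - y) = ?Y n x - ?Y n y" for n x y
    using Yadd[of n "x - y" y] by simp
  have Ynorm: "norm (?Y n x) \<le> ?y n * norm x" for n x
  proof (induction n arbitrary: x)
    case (Suc n)
    have "norm (?Y n (?Y n x)) \<le> ?y n * norm (?Y n x)" by (rule Suc)
    also have "\<dots> \<le> ?y n * (?y n * norm x)"
      using Suc sqrt_iter_real_bounds by (intro mult_left_mono) auto
    finally have "norm (X x + ?Y n (?Y n x)) \<le> norm x + ?y n * (?y n * norm x)"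
      using X1[of x] by (intro norm_triangle_le) linarith
    then show ?case
      by (simp add: power2_eq_square algebra_simps del: scaleR_add_right)
  qed simp
  have Ynorm1: "norm (?Y n x) \<le> norm x" for n x
    using Ynorm[of n x] sqrt_iter_real_bounds[of n]
    by (meson mult_left_le_one_le norm_ge_zero order_trans)
  have Ystep: "norm (?Y (Suc n) x - ?Y n x) \<le> (?y (Suc n) - ?y n) * norm x" for n x
  proof (induction n arbitrary: x)
    case 0
    then show ?case using X1[of x] by simp
  next
    case (Suc n)
    define d where "d = ?y (Suc n) - ?y n"
    have d0: "0 \<le> d" using sqrt_iter_real_le_Suc[of n] by (simp add: d_def)
    let ?D = "\<lambda>x. ?Y (Suc n) x - ?Y n x"
    have "2 *\<^sub>R (?Y (Suc (Suc n)) x - ?Y (Suc n) x)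
        = ?Y (Suc n) (?Y (Suc n) x) - ?Y n (?Y n x)"
      by (subst (1) sqrt_iter.simps(2), subst (3) sqrt_iter.simps(2))
         (simp add: scaleR_diff_right del: sqrt_iter.simps)
    \<comment> \<open>A difference of squares, with the factors ordered so that the identity holds
      without commuting the iterates.\<close>
    also have "\<dots> = ?Y (Suc n) (?D x) + ?D (?Y n x)"
      by (simp add: Ydiff del: sqrt_iter.simps)
    finally have eq: "2 *\<^sub>R (?Y (Suc (Suc n)) x - ?Y (Suc n) x) = \<dots>" .
    have "norm (?Y (Suc n) (?D x)) \<le> ?y (Suc n) * norm (?D x)" by (rule Ynorm)
    also have "\<dots> \<le> ?y (Suc n) * (d * norm x)"
      unfolding d_def using Suc sqrt_iter_real_bounds by (intro mult_left_mono) blast+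
    finally have 1: "norm (?Y (Suc n) (?D x)) \<le> ?y (Suc n) * (d * norm x)" .
    have "norm (?D (?Y n x)) \<le> d * norm (?Y n x)" unfolding d_def by (rule Suc)
    also have "\<dots> \<le> d * (?y n * norm x)" using Ynorm d0 by (intro mult_left_mono) blast+
    finally have 2: "norm (?D (?Y n x)) \<le> d * (?y n * norm x)" .
    have "2 * norm (?Y (Suc (Suc n)) x - ?Y (Suc n) x)
        = norm (2 *\<^sub>R (?Y (Suc (Suc n)) x - ?Y (Suc n) x))"
      by (simp del: sqrt_iter.simps)
    also have "\<dots> \<le> ?y (Suc n) * (d * norm x) + d * (?y n * norm x)"
      unfolding eq using 1 2 by (intro norm_triangle_le) linarith
    also have "\<dots> = ((?y (Suc n))\<^sup>2 - (?y n)\<^sup>2) * norm x"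
      by (simp add: d_def power2_eq_square algebra_simps del: sqrt_iter_real.simps)
    \<comment> \<open>Subtracting consecutive instances of the scalar recursion turns the bound into
      exactly the next scalar increment.\<close>
    also have "((?y (Suc n))\<^sup>2 - (?y n)\<^sup>2) = 2 * (?y (Suc (Suc n)) - ?y (Suc n))"
      using sqrt_iter_real.simps(2)[of n] sqrt_iter_real.simps(2)[of "Suc n"]
      by (simp del: sqrt_iter_real.simps)
    finally show ?case by (simp only: mult.assoc mult_le_cancel_left_pos zero_less_numeral)
  qed
  have Ydist: "norm (?Y (n + k) x - ?Y n x) \<le> (?y (n + k) - ?y n) * norm x" for n k x
  proof (induction k)
    case (Suc k)
    have "norm (?Y (Suc (n + k)) x - ?Y n x)
        \<le> norm (?Y (Suc (n + k)) x - ?Y (n + k) x) + norm (?Y (n + k) x - ?Y n x)"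
      using norm_triangle_ineq[of "?Y (Suc (n + k)) x - ?Y (n + k) x" "?Y (n + k) x - ?Y n x"]
      by (simp del: sqrt_iter.simps)
    also have "\<dots> \<le> (?y (Suc (n + k)) - ?y n) * norm x"
      using Ystep[of "n + k" x] Suc
      by (simp add: left_diff_distrib del: sqrt_iter.simps sqrt_iter_real.simps)
    finally show ?case by (simp only: add_Suc_right)
  qed simp
  have "convergent (\<lambda>n. ?Y n x)" for x
  proof -
    \<comment> \<open>By \<open>Ydist\<close> the distances between iterates are dominated by those
      of this convergent scalar sequence.\<close>
    have "Cauchy (\<lambda>n. ?y n * norm x)"
      using convergent_sqrt_iter_real
      by (intro convergent_Cauchy) (auto simp: convergent_def intro!: tendsto_mult_right)
    moreover have "dist (?Y m x) (?Y n x) \<le> dist (?y m * norm x) (?y n * norm x)" for m n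
    proof (induction m n rule: linorder_wlog)
      case (le m n)
      then obtain k where "n = m + k" using le_Suc_ex by blast
      then have "norm (?Y n x - ?Y m x) \<le> \<bar>?y n * norm x - ?y m * norm x\<bar>"
        using Ydist[of m k x] by (simp add: left_diff_distrib)
      then show ?case by (simp add: dist_norm norm_minus_commute abs_minus_commute)
    qed (simp add: dist_commute)
    ultimately have "Cauchy (\<lambda>n. ?Y n x)"
      unfolding Cauchy_def by (meson le_less_trans)
    then show ?thesis by (rule Cauchy_convergent)
  qed
  then have "\<forall>x. \<exists>l. (\<lambda>n. ?Y n x) \<longlonglongrightarrow> l" by (simp add: convergent_def)
  from choice[OF this] obtain Y where lim: "\<And>x. (\<lambda>n. ?Y n x) \<longlonglongrightarrow> Y x" by blast
  have add: "Y (x + y) = Y x + Y y" for x y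
    using tendsto_add[OF lim lim, of x y] lim[of "x + y"] by (simp add: Yadd LIMSEQ_unique)
  \<comment> \<open>Continuity of multiplication by \<open>c\<close> follows by splitting
    \<open>c\<close> into real and imaginary parts, since multiplication by \<open>\<i>\<close>
    preserves norms.\<close>
  have cont: "(\<lambda>n. c *\<^sub>C ?Y n x) \<longlonglongrightarrow> c *\<^sub>C Y x" for c x
  proof -
    have "c *\<^sub>C z = Re c *\<^sub>R z + Im c *\<^sub>R (\<i> *\<^sub>C z)" for z :: 'a
      using complex_eq[of c] by (simp add: scaleR_scaleC scaleC_scaleC mult.commute
          flip: scaleC_add_left)
    moreover have "(\<lambda>n. \<i> *\<^sub>C ?Y n x) \<longlonglongrightarrow> \<i> *\<^sub>C Y x"
    proof -
      have "(\<lambda>n. norm (?Y n x - Y x)) \<longlonglongrightarrow> 0"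
        using lim LIM_zero tendsto_norm_zero by blast
      then have "(\<lambda>n. norm (\<i> *\<^sub>C ?Y n x - \<i> *\<^sub>C Y x)) \<longlonglongrightarrow> 0"
        by (simp add: norm_scaleC_i flip: scaleC_diff_right)
      then show ?thesis by (rule LIM_zero_cancel[OF tendsto_norm_zero_cancel])
    qed
    ultimately show ?thesis using lim[of x] by (auto intro!: tendsto_intros)
  qed
  have scale: "Y (c *\<^sub>C x) = c *\<^sub>C Y x" for c x
    using cont[of c x] lim[of "c *\<^sub>C x"] by (simp add: Yc LIMSEQ_unique)
  have norm1: "norm (Y x) \<le> norm x" for x
    by (rule LIMSEQ_le_const2[OF tendsto_norm[OF lim]]) (use Ynorm1 in blast)
  have adjR: "inner (Y x) y = inner x (Y y)" for x y
  proof -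
    have "(\<lambda>n. inner (?Y n x) y) \<longlonglongrightarrow> inner (Y x) y" by (intro tendsto_intros lim)
    moreover have "(\<lambda>n. inner x (?Y n y)) \<longlonglongrightarrow> inner x (Y y)" by (intro tendsto_intros lim)
    ultimately show ?thesis by (simp add: inner_eq_Re_cinner Yadj LIMSEQ_unique)
  qed
  have adj: "cinner (Y x) y = cinner x (Y y)" for x y
    by (simp add: cinner_eq_iff_inner adjR flip: scale)
  have Y_eq: "2 *\<^sub>R Y x = X x + Y (Y x)" for x
  proof -
    \<comment> \<open>To pass to the limit in the square, \<open>?Y n (?Y n x)\<close> is split into
      this term and \<open>?Y n (Y x)\<close>. The first tends to 0 because all iterates are
      contractions.\<close>
    have "(\<lambda>n. ?Y n (?Y n x - Y x)) \<longlonglongrightarrow> 0"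
    proof (rule Lim_null_comparison)
      show "\<forall>\<^sub>F n in sequentially. norm (?Y n (?Y n x - Y x)) \<le> norm (?Y n x - Y x)"
        using Ynorm1 by simp
      show "(\<lambda>n. norm (?Y n x - Y x)) \<longlonglongrightarrow> 0"
        using lim LIM_zero tendsto_norm_zero by blast
    qed
    from tendsto_add[OF this lim[of "Y x"]]
    have "(\<lambda>n. ?Y n (?Y n x)) \<longlonglongrightarrow> Y (Y x)" by (simp add: Ydiff)
    then have "(\<lambda>n. X x + ?Y n (?Y n x)) \<longlonglongrightarrow> X x + Y (Y x)" by (intro tendsto_intros)
    moreover have "(\<lambda>n. 2 *\<^sub>R ?Y (Suc n) x) \<longlonglongrightarrow> 2 *\<^sub>R Y x"
      by (intro tendsto_intros LIMSEQ_Suc[OF lim])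
    ultimately show ?thesis by (simp add: LIMSEQ_unique)
  qed
  let ?P = "\<lambda>x. x - Y x"
  have Yd: "Y (x - y) = Y x - Y y" for x y using add[of "x - y" y] by simp
  have "norm (?P x) \<le> 2 * norm x" for x
    using norm_triangle_ineq4[of x "Y x"] norm1[of x] by simp
  then have "bounded_op ?P" by (intro bounded_opI) (simp_all add: add scale scaleC_diff_right)
  then have "self_adjoint ?P" by (rule self_adjointI) (simp add: cinner_diff_left cinner_diff_right adj)
  moreover have "0 \<le> Re (cinner (?P x) x)" for x
  proof -
    have "inner (Y x) x \<le> norm (Y x) * norm x" by (rule norm_cauchy_schwarz)
    also have "\<dots> \<le> norm x * norm x" using norm1 by (intro mult_right_mono) auto
    also have "\<dots> = inner x x" by (metis power2_eq_square power2_norm_eq_inner)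
    finally show ?thesis by (simp add: cinner_diff_left inner_eq_Re_cinner)
  qed
  moreover have "?P (?P x) = x - X x" for x
    using Y_eq[of x] by (simp add: Yd scaleR_2 algebra_simps)
  ultimately show ?thesis unfolding positive_op_def by blast
qed

text \<open>Dividing \<open>cadjoint T \<circ> T\<close> by the square of a bound \<open>k\<close>
  for \<open>T\<close> makes its difference \<open>X\<close> from the identity a self-adjoint
  contraction. The root of \<open>I - X\<close>, multiplied by \<open>k\<close>, is the required
  one.\<close>

lemma square_root_exists:
  fixes T :: "'a::complex_hilbert \<Rightarrow> 'a"
  assumes T: "bounded_op T"
  shows "\<exists>P. positive_op P \<and> P \<circ> P = cadjoint T \<circ> T"
proof -
  obtain k where k: "k > 0" "\<And>x. norm (T x) \<le> k * norm x"
    using bounded_op_pos_bound[OF T] by blast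
  let ?B = "cadjoint T"
  have B: "bounded_op ?B" "\<And>y. norm (?B y) \<le> k * norm y" using bounded_op_cadjoint[OF T k(2)] .
  define X where "X = (\<lambda>x. x - (1 / k\<^sup>2) *\<^sub>R ?B (T x))"
  have adj: "cinner (?B x) y = cinner x (T y)" for x y
    using cinner_cadjoint[OF T, of y x] cinner_commute[of "?B x" y] cinner_commute[of x "T y"]
    by simp
  have Xadj: "cinner (X x) y = cinner x (X y)" for x y
    by (simp add: X_def cinner_diff_left cinner_diff_right scaleR_scaleC cinner_scaleC_left
        cinner_scaleC_right adj flip: cinner_cadjoint[OF T])
  have X1: "norm (X x) \<le> norm x" for x
  proof -
    have "inner x (?B (T x)) = (norm (T x))\<^sup>2"
      by (simp add: inner_eq_Re_cinner power2_norm_eq_inner flip: cinner_cadjoint[OF T])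
    moreover have "(norm (x - a *\<^sub>R b))\<^sup>2 = (norm x)\<^sup>2 - 2 * a * inner x b + (a * norm b)\<^sup>2" for a b
      by (simp add: power_mult_distrib power2_norm_eq_inner inner_diff inner_commute algebra_simps
          power2_eq_square[of a])
    \<comment> \<open>In the expanded square the cross term is \<open>- 2 * q\<close>, while the
      last term is at most \<open>q\<close> because \<open>k\<close> also bounds the adjoint. Hence
      the sum is at most the squared norm of \<open>x\<close>.\<close>
    moreover define q where "q = (norm (T x))\<^sup>2 / k\<^sup>2"
    ultimately have "(norm (X x))\<^sup>2 = (norm x)\<^sup>2 - 2 * q + (norm (?B (T x)) / k\<^sup>2)\<^sup>2"
      by (simp add: X_def)
    moreover have "(norm (?B (T x)) / k\<^sup>2)\<^sup>2 \<le> (k * norm (T x) / k\<^sup>2)\<^sup>2"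
      using B(2) by (intro power_mono divide_right_mono) auto
    moreover have "(k * norm (T x) / k\<^sup>2)\<^sup>2 = q"
      using k(1) by (simp add: q_def power2_eq_square)
    moreover have "0 \<le> q" by (simp add: q_def)
    ultimately have "(norm (X x))\<^sup>2 \<le> (norm x)\<^sup>2" by linarith
    then show ?thesis by (rule power2_le_imp_le) simp
  qed
  have "bounded_op X"
    by (rule bounded_opI[where K = 1])
       (auto simp: X1, auto simp: X_def bounded_op_add[OF T] bounded_op_add[OF B(1)]
          bounded_op_scaleC[OF T] bounded_op_scaleC[OF B(1)] scaleC_diff_right scaleC_scaleR
          algebra_simps)
  then have "self_adjoint X" using Xadj by (rule self_adjointI)
  from one_minus_square_root[OF this X1]
  obtain Q where Q: "positive_op Q" "\<And>x. Q (Q x) = x - X x" by blast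
  have sQ: "self_adjoint Q" and bQ: "bounded_op Q"
    using Q(1) by (auto simp: positive_op_def self_adjoint_def)
  let ?P = "\<lambda>x. k *\<^sub>R Q x"
  obtain q where q: "\<And>x. norm (Q x) \<le> q * norm x" using bounded_op_pos_bound[OF bQ] by blast
  have "bounded_op ?P"
    using k(1) q by (intro bounded_opI[where K = "k * q"])
      (auto simp: bounded_op_add[OF bQ] bounded_op_scaleC[OF bQ] scaleC_scaleR scaleR_add_right
        mult.assoc)
  then have "self_adjoint ?P"
    by (rule self_adjointI)
       (simp add: scaleR_scaleC cinner_scaleC_left cinner_scaleC_right self_adjoint_cinner[OF sQ])
  then have "positive_op ?P"
    using Q(1) k(1) by (auto simp: positive_op_def cinner_scaleR_left)
  moreover have "?P \<circ> ?P = ?B \<circ> T"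
    using k(1) by (auto simp: bounded_op_on_scaleR[OF bQ] Q(2) X_def power2_eq_square)
  ultimately show ?thesis by blast
qed

section \<open>The modulus and the real part of an operator\<close>

text \<open>Existence of a square root guarantees that the choice in \<open>op_sqrt\<close> meets
  its specification.\<close>

lemma
  fixes T :: "'a::complex_hilbert \<Rightarrow> 'a"
  assumes "bounded_op T"
  shows positive_op_abs: "positive_op (op_abs T)"
    and op_abs_square: "op_abs T (op_abs T x) = cadjoint T (T x)"
  using someI_ex[OF square_root_exists[OF assms]]
  unfolding op_abs_def op_sqrt_def by (auto simp: fun_eq_iff)

lemma norm_op_abs:
  fixes T :: "'a::complex_hilbert \<Rightarrow> 'a"
  assumes T: "bounded_op T"
  shows "norm (op_abs T x) = norm (T x)"
proof -
  have "self_adjoint (op_abs T)" using positive_op_abs[OF T] by (simp add: positive_op_def)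
  then have "cinner (op_abs T x) (op_abs T x) = cinner (T x) (T x)"
    by (simp add: self_adjoint_cinner op_abs_square[OF T] cinner_cadjoint[OF T])
  then show ?thesis by (simp add: norm_eq_sqrt_inner inner_eq_Re_cinner)
qed

text \<open>The defect \<open>d = P x - x\<close> satisfies \<open>P d = - d\<close>, which
  positivity permits only for \<open>d = 0\<close>. This gives the modulus on vectors fixed by
  \<open>cadjoint T \<circ> T\<close> without spectral theory.\<close>

lemma positive_op_square_fixpoint:
  assumes P: "positive_op P" and PP: "P (P x) = x"
  shows "P x = x"
proof -
  define d where "d = P x - x"
  have "bounded_linear P"
    using P by (auto simp: positive_op_def self_adjoint_def bounded_op_imp_bounded_linear)
  then have "P d = - d" by (simp add: d_def PP bounded_linear.linear linear_diff)
  moreover have "0 \<le> inner (P d) d" using P by (simp add: positive_op_def inner_eq_Re_cinner)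
  ultimately have "d = 0" by (simp flip: power2_norm_eq_inner)
  then show ?thesis by (simp add: d_def)
qed

text \<open>Boundedness makes the modulus facts available for \<open>op_Re T\<close>; the bound of
  \<open>T\<close> also serves its adjoint, hence their average.\<close>

lemma bounded_op_Re:
  fixes T :: "'a::complex_hilbert \<Rightarrow> 'a"
  assumes T: "bounded_op T"
  shows "bounded_op (op_Re T)"
proof -
  obtain K where K: "\<And>x. norm (T x) \<le> K * norm x" using bounded_op_pos_bound[OF T] by blast
  note B = bounded_op_cadjoint[OF T K]
  have "norm (op_Re T x) \<le> K * norm x" for x
    using norm_triangle_ineq[of "T x" "cadjoint T x"] K[of x] B(2)[of x] by (simp add: op_Re_def)
  then show ?thesis
    by (intro bounded_opI)
       (auto simp: op_Re_def bounded_op_add[OF T] bounded_op_add[OF B(1)] bounded_op_scaleC[OF T]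
          bounded_op_scaleC[OF B(1)] scaleC_scaleR scaleC_add_right algebra_simps)
qed

section \<open>Brownian isometries\<close>

text \<open>The modulus of \<open>T\<close> fixes \<open>x\<close>, so the operator inequality
  tested at \<open>x\<close> bounds \<open>inner x x\<close>. Cauchy-Schwarz and
  \<open>norm_op_abs\<close> then replace the modulus of \<open>op_Re T\<close> by
  \<open>op_Re T\<close> itself.\<close>

lemma op_abs_le_Re_imp_norm_le:
  fixes T :: "'a::complex_hilbert \<Rightarrow> 'a"
  assumes T: "bounded_op T" and le: "op_le (op_abs T) (op_abs (op_Re T))"
    and x: "cadjoint T (T x) = x"
  shows "norm x \<le> norm (op_Re T x)"
proof (cases "x = 0")
  case False
  have "op_abs T x = x"
    by (rule positive_op_square_fixpoint[OF positive_op_abs[OF T]])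
       (simp add: op_abs_square[OF T] x)
  then have "inner x x \<le> inner (op_abs (op_Re T) x) x"
    using le by (auto simp: op_le_def positive_op_def inner_diff_left
        simp flip: inner_eq_Re_cinner dest: spec[of _ x])
  also have "\<dots> \<le> norm (op_abs (op_Re T) x) * norm x" by (rule norm_cauchy_schwarz)
  also have "\<dots> = norm (op_Re T x) * norm x" by (simp add: norm_op_abs bounded_op_Re T)
  finally show ?thesis using False by (simp add: power2_eq_square flip: power2_norm_eq_inner)
qed simp

theorem corollary3p9:
  fixes T :: "'a::complex_hilbert \<Rightarrow> 'a" and \<sigma> :: real
  assumes "\<sigma> > 0"
    and "brownian_isometry \<sigma> T"
    and "op_le (op_abs T) (op_abs (op_Re T))"
  shows "symmetry T"
proof -
  have T: "bounded_op T" and \<sigma>: "\<sigma>\<^sup>2 = onorm (\<lambda>x. cadjoint T (T x) - x)"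
    using assms(2) by (auto simp: brownian_isometry_def two_isometry_def)
  obtain H\<^sub>0 H\<^sub>1 V E U where dec: "orthogonal_decomposition H\<^sub>0 H\<^sub>1"
    and block: "\<And>x y. x \<in> H\<^sub>0 \<Longrightarrow> y \<in> H\<^sub>1 \<Longrightarrow> T (x + y) = (V x + \<sigma> *\<^sub>R E y) + U y"
    and V: "isometry_on H\<^sub>0 V" and E: "bounded_op_on H\<^sub>1 H\<^sub>0 E" and inj: "inj_on E H\<^sub>1"
    and VE: "\<And>y. y \<in> H\<^sub>1 \<Longrightarrow> adjoint_on H\<^sub>0 H\<^sub>0 V (E y) = 0"
    and U: "bounded_op_on H\<^sub>1 H\<^sub>1 U"
    using assms(2) unfolding brownian_isometry_def contraction_on_def unitary_on_def by blast
  have H: "closed_csubspace H\<^sub>0" "closed_csubspace H\<^sub>1" and sub: "subspace H\<^sub>0" "subspace H\<^sub>1"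
    and orth: "\<And>x y. x \<in> H\<^sub>0 \<Longrightarrow> y \<in> H\<^sub>1 \<Longrightarrow> cinner x y = 0"
    and sum: "\<And>z. \<exists>x\<in>H\<^sub>0. \<exists>y\<in>H\<^sub>1. z = x + y"
    using dec by (auto simp: orthogonal_decomposition_def closed_csubspace_def)
  have orth': "cinner y x = 0" if "x \<in> H\<^sub>0" "y \<in> H\<^sub>1" for x y
    using orth[OF that] cinner_commute[of y x] by simp
  have bV: "bounded_op_on H\<^sub>0 H\<^sub>0 V" using V by (simp add: isometry_on_def)
  have VH: "V x \<in> H\<^sub>0" if "x \<in> H\<^sub>0" for x using bV that by (auto simp: bounded_op_on_def)
  have EH: "E y \<in> H\<^sub>0" if "y \<in> H\<^sub>1" for y using E that by (auto simp: bounded_op_on_def)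
  have UH: "U y \<in> H\<^sub>1" if "y \<in> H\<^sub>1" for y using U that by (auto simp: bounded_op_on_def)
  have TV: "T x = V x" if "x \<in> H\<^sub>0" for x
    using block[of x 0] that sub bounded_op_on_zero[OF E] bounded_op_on_zero[OF U]
    by (simp add: subspace_0)
  have VV: "cinner (V x) (V y) = cinner x y" if "x \<in> H\<^sub>0" "y \<in> H\<^sub>0" for x y
    using cinner_adjoint_on[OF H(1) bV that(1) VH[OF that(2)]] V that by (simp add: isometry_on_def)
  \<comment> \<open>The range of \<open>E\<close> lies in the null-space of the adjoint of
    \<open>V\<close>, hence is orthogonal to the range of \<open>V\<close>.\<close>
  have V_perp_E: "cinner (V x) (E y) = 0" if "x \<in> H\<^sub>0" "y \<in> H\<^sub>1" for x y
    using cinner_adjoint_on[OF H(1) bV that(1) EH[OF that(2)]] VE[OF that(2)]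
      cinner_commute[of x 0] by (simp add: cinner_zero_left)
  \<comment> \<open>Tested against \<open>z = x + y\<close>, the parts \<open>E y\<close> and
    \<open>U y\<close> of \<open>T z\<close> are orthogonal to \<open>V w\<close>. What remains is
    the inner product of \<open>V x\<close> with \<open>V w\<close>, which equals that of
    \<open>z\<close> with \<open>w\<close>.\<close>
  have TstarV: "cadjoint T (V w) = w" if w: "w \<in> H\<^sub>0" for w
  proof (rule cinner_right_cancel)
    fix z
    obtain x y where z: "x \<in> H\<^sub>0" "y \<in> H\<^sub>1" "z = x + y" using sum by blast
    have "cinner (E y) (V w) = 0"
      using V_perp_E[OF w z(2)] cinner_commute[of "E y" "V w"] by simp
    then have "cinner (T z) (V w) = cinner z w"
      using z w by (simp add: block cinner_add_left cinner_scaleR_left VV orth' UH VH)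
    then show "cinner z (cadjoint T (V w)) = cinner z w" by (simp add: cinner_cadjoint[OF T])
  qed
  have "y = 0" if y: "y \<in> H\<^sub>1" for y
  proof -
    \<comment> \<open>This vector lies in the range of \<open>V\<close>, where \<open>TstarV\<close>
      evaluates the adjoint of \<open>T\<close>, and its image \<open>V ?x\<close> is orthogonal to
      \<open>?e\<close>.\<close>
    let ?e = "E y" and ?x = "V (E y)"
    have norm_V: "norm (V w) = norm w" if "w \<in> H\<^sub>0" for w
      by (simp add: norm_eq_sqrt_inner inner_eq_Re_cinner VV that)
    have "norm ?x \<le> norm (op_Re T ?x)"
      by (rule op_abs_le_Re_imp_norm_le[OF T assms(3)])
         (simp add: TV TstarV VH EH y)
    also have "op_Re T ?x = (1/2) *\<^sub>R (V ?x + ?e)"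
      by (simp add: op_Re_def TV TstarV VH EH y)
    finally have "(2 * norm ?e)\<^sup>2 \<le> (norm (V ?x + ?e))\<^sup>2"
      by (intro power_mono) (auto simp: norm_V EH y)
    also have "\<dots> = (norm (V ?x))\<^sup>2 + (norm ?e)\<^sup>2"
      by (rule norm_add_Pythagorean)
         (simp add: orthogonal_def inner_eq_Re_cinner V_perp_E VH EH y)
    also have "\<dots> = 2 * (norm ?e)\<^sup>2" by (simp add: norm_V VH EH y)
    \<comment> \<open>Four times the squared norm of \<open>?e\<close> is at most twice it, so
      \<open>?e\<close> vanishes; it is written as \<open>E 0\<close> to invoke injectivity.\<close>
    finally have "E y = E 0"
      using bounded_op_on_zero[OF E sub(2)] by (simp add: power_mult_distrib)
    then show ?thesis using inj y sub by (auto simp: inj_on_def subspace_0)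
  qed
  then have "z \<in> H\<^sub>0" for z using sum[of z] by (metis add.right_neutral)
  \<comment> \<open>With \<open>H\<^sub>0\<close> the whole space, \<open>T\<close> coincides with
    \<open>V\<close>, and the covariance would have to be 0.\<close>
  then have "cadjoint T (T x) - x = 0" for x by (simp add: TV TstarV)
  then have "\<sigma>\<^sup>2 = 0" by (simp add: \<sigma> onorm_zero)
  then show ?thesis using assms(1) by simp
qed

end
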